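(* Let $n\ge 1$ and let $\alpha\in\mathcal{T}_n$. (a) $\alpha\in\mathcal{P}_n$ if and only if for every oriented quadruple $S=(a,b,c,d)$ of members of $[n]$, the quadruple $S\alpha$ is also oriented. (b) $\alpha$ has the chord property if and only if $\alpha\in\mathcal{P}_n$.
   Context: Let $[n]=\{0,1,\dots,n-1\}$ and let $\mathcal{T}_n$ be the full transformation semigroup on $[n]$, i.e. all mappings $\alpha:[n]\to[n]$, written on the right ($x\mapsto x\alpha$). For a finite sequence $S=(a_0,a_1,\dots,a_{t-1})$ with entries in $[n]$ (repetitions allowed), put $S\alpha=(a_0\alpha,\dots,a_{t-1}\alpha)$. The sequence $S$ is cyclic if there is at most one subscript $i\in\{0,\dots,t-1\}$ with $a_i>a_{i+1}$ (subscripts modulo $t$), and anti-cyclic if there is at most one subscript $i$ with $a_i<a_{i+1}$ (subscripts modulo $t$). $S$ is oriented if it is cyclic or anti-cyclic. $\mathcal{OP}_n$ is the set of $\alpha\in\mathcal{T}_n$ for which the sequence $(0,1,\dots,n-1)\alpha$ is cyclic; $\mathcal{OR}_n$ is the set of $\alpha\in\mathcal{T}_n$ for which $(0,1,\dots,n-1)\alpha$ is anti-cyclic; $\mathcal{P}_n=\mathcal{OP}_n\cup\mathcal{OR}_n$. Chord property: place the integers $0,1,\dots,n-1$ as distinct points in clockwise order around a circle. For $a,c\in[n]$, the chord $ac$ is the closed straight line segment joining the points $a$ and $c$ (a single point if $a=c$). Two chords intersect (meet) if they have a common point, shared endpoints included. A mapping $\alpha\in\mathcal{T}_n$ has the chord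 property if, for all $a,b,c,d\in[n]$, whenever the chords $ac$ and $bd$ intersect, the chord joining $a\alpha$ and $c\alpha$ intersects the chord joining $b\alpha$ and $d\alpha$. *)

theory Defs
  imports "HOL-Analysis.Analysis"
begin

text \<open>Mappings of \<open>[n]\<close> are extensional functions on \<open>{..<n}\<close>, so that the elements of
  \<open>full_transf n\<close> correspond one-to-one to the mappings \<open>[n] \<rightarrow> [n]\<close>. The image
  \<open>S\<alpha>\<close> of a sequence is \<open>map \<alpha> S\<close>.\<close>

definition full_transf :: "nat \<Rightarrow> (nat \<Rightarrow> nat) set" where
  "full_transf n = {..<n} \<rightarrow>\<^sub>E {..<n}"

definition cyclic_seq :: "nat list \<Rightarrow> bool" where
  "cyclic_seq S \<longleftrightarrow>
     card {i. i < length S \<and> S ! i > S ! ((i + 1) mod length S)} \<le> 1"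

definition anticyclic_seq :: "nat list \<Rightarrow> bool" where
  "anticyclic_seq S \<longleftrightarrow>
     card {i. i < length S \<and> S ! i < S ! ((i + 1) mod length S)} \<le> 1"

definition oriented_seq :: "nat list \<Rightarrow> bool" where
  "oriented_seq S \<longleftrightarrow> cyclic_seq S \<or> anticyclic_seq S"

definition OP_set :: "nat \<Rightarrow> (nat \<Rightarrow> nat) set" where
  "OP_set n = {\<alpha> \<in> full_transf n. cyclic_seq (map \<alpha> [0..<n])}"

definition OR_set :: "nat \<Rightarrow> (nat \<Rightarrow> nat) set" where
  "OR_set n = {\<alpha> \<in> full_transf n. anticyclic_seq (map \<alpha> [0..<n])}"

definition P_set :: "nat \<Rightarrow> (nat \<Rightarrow> nat) set" where
  "P_set n = OP_set n \<union> OR_set n"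

text \<open>Here \<open>p k\<close> is the point at which \<open>k\<close> is placed and \<open>\<theta> k\<close> its polar angle about the
  centre \<open>z\<close>. Clockwise order means that the angles decrease; since they all lie within less
  than one full turn, the points are distinct and go round the circle at most once.\<close>

definition clockwise_placement :: "nat \<Rightarrow> (nat \<Rightarrow> complex) \<Rightarrow> bool" where
  "clockwise_placement n p \<longleftrightarrow>
     (\<exists>(z :: complex) (r :: real) (\<theta> :: nat \<Rightarrow> real).
        r > 0 \<and>
        (\<forall>i<n. \<forall>j<n. i < j \<longrightarrow> \<theta> j < \<theta> i \<and> \<theta> i - \<theta> j < 2 * pi) \<and>
        (\<forall>k<n. p k = z + of_real r * cis (\<theta> k)))"

lemma clockwise_placement_regular_polygon:
  "clockwise_placement n (\<lambda>k. cis (- (2 * pi * real k / real n)))"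
proof -
  have "2 * pi * real i / real n < 2 * pi * real j / real n \<and>
        2 * pi * real j / real n - 2 * pi * real i / real n < 2 * pi"
    if "i < n" "j < n" "i < j" for i j
  proof -
    have "2 * pi * real j / real n - 2 * pi * real i / real n
            = 2 * pi * ((real j - real i) / real n)"
      by (simp add: diff_divide_distrib algebra_simps)
    also have "\<dots> < 2 * pi * 1"
      using that by (intro mult_strict_left_mono) auto
    finally show ?thesis
      using that by (simp add: divide_strict_right_mono)
  qed
  then show ?thesis
    unfolding clockwise_placement_def
    by (intro exI[of _ 0] exI[of _ 1] exI[of _ "\<lambda>k. - (2 * pi * real k / real n)"]) auto
qed

definition chord :: "(nat \<Rightarrow> complex) \<Rightarrow> nat \<Rightarrow> nat \<Rightarrow> complex set" where
  "chord p a c = closed_segment (p a) (p c)"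

definition chord_property :: "nat \<Rightarrow> (nat \<Rightarrow> complex) \<Rightarrow> (nat \<Rightarrow> nat) \<Rightarrow> bool" where
  "chord_property n p \<alpha> \<longleftrightarrow>
     (\<forall>a<n. \<forall>b<n. \<forall>c<n. \<forall>d<n.
        chord p a c \<inter> chord p b d \<noteq> {} \<longrightarrow>
        chord p (\<alpha> a) (\<alpha> c) \<inter> chord p (\<alpha> b) (\<alpha> d) \<noteq> {})"

end

theory Submission
  imports Defs
begin

text \<open>
  Call a place where a cyclic sequence goes strictly down a descent and one where it goes
  strictly up an ascent. A mapping lies outside \<open>P_set n\<close> exactly when its sequence of images
  has at least two descents and at least two ascents, and the same description applies to
  quadruples. The proof rests on two observations.

  \<^bold>\<open>A failure is already visible in four places.\<close> A descent between two chosen places of a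
  cyclic sequence forces a descent of the sequence somewhere between them, so if four places
  taken in cyclic order carry a quadruple that is not oriented, the whole sequence has two
  descents and two ascents (\<open>two_steps_of_not_oriented\<close>). Conversely, given two ascents and two
  descents, read them in cyclic order. If they alternate, a peak, a valley, a peak and a valley
  can be found, and these form a quadruple that is not oriented
  (\<open>not_oriented_of_alternating_steps\<close>). Otherwise the two ascents come first and the two
  descents after them; then either some further step makes four of the steps alternate, or there
  are a low value, an intermediate value on the way up, a high value and an intermediate value on
  the way down, which again form a quadruple that is not oriented
  (\<open>not_oriented_of_grouped_steps\<close>). Places in cyclic order are just the places of an
  oriented quadruple read in one of the two directions, which gives the characterisation of
  \<open>P_set n\<close> by quadruples (\<open>in_P_iff_preserves_oriented_quads\<close>).

  \<^bold>\<open>Chords meet exactly for oriented quadruples.\<close> For points on a circle, the chords \<open>ac\<close> and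
  \<open>bd\<close> meet if and only if \<open>(a, b, c, d)\<close> is oriented (\<open>chords_meet_iff_oriented\<close>), degenerate
  chords included. Three points in clockwise order span a triangle of negative signed area. Hence
  for a quadruple that is not oriented, one chord lies strictly on one side of the line through
  the other, unless both chords are single points, which are then different; in
  contrast, the diagonals of a convex quadrilateral have an explicit common point. The chord
  property thereby says that oriented quadruples are sent to oriented quadruples, so the second
  claim follows from the first.
\<close>

section \<open>Steps of a cyclic sequence\<close>

text \<open>
  The periodic extension of a cyclic sequence. It turns places in cyclic order, with an arbitrary
  starting place, into an increasing sequence within one period, so that no step has to be treated
  specially because it wraps around.
\<close>

definition unroll :: "nat \<Rightarrow> (nat \<Rightarrow> 'a) \<Rightarrow> nat \<Rightarrow> 'a" where
  "unroll n f i = f (i mod n)"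

text \<open>
  The window of length \<open>n\<close> may start anywhere. For an \<open>n\<close>-periodic \<open>x\<close> this loses nothing and
  allows steps to be read off in any rotation.
\<close>

definition two_steps :: "('a \<Rightarrow> 'a \<Rightarrow> bool) \<Rightarrow> nat \<Rightarrow> (nat \<Rightarrow> 'a) \<Rightarrow> bool" where
  "two_steps R n x \<longleftrightarrow> (\<exists>i j. i < j \<and> j < i + n \<and> R (x i) (x (Suc i)) \<and> R (x j) (x (Suc j)))"

lemma unroll_Suc_mod: "unroll n f (Suc (i mod n)) = unroll n f (Suc i)"
  by (simp add: unroll_def mod_Suc_eq)

lemma unroll_mod: "unroll n f (i mod n) = unroll n f i"
  by (simp add: unroll_def)

lemma unroll_add: "unroll n f (i + n) = unroll n f i"
  by (simp add: unroll_def)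

lemma two_steps_unroll_iff:
  "two_steps R n (unroll n f) \<longleftrightarrow>
     (\<exists>i j. i < j \<and> j < n \<and> R (unroll n f i) (unroll n f (Suc i)) \<and> R (unroll n f j) (unroll n f (Suc j)))"
  (is "?L \<longleftrightarrow> ?R")
proof
  let ?x = "unroll n f"
  assume ?L
  then obtain i j where ij: "i < j" "j < i + n" "R (?x i) (?x (Suc i))" "R (?x j) (?x (Suc j))"
    unfolding two_steps_def by blast
  have "i mod n \<noteq> j mod n"
  proof
    assume "i mod n = j mod n"
    then have "n dvd j - i"
      using ij(1) mod_eq_dvd_iff_nat[of i j n] by simp
    then show False
      using ij(1,2) by (auto dest: dvd_imp_le)
  qed
  moreover have "R (?x (i mod n)) (?x (Suc (i mod n)))" "R (?x (j mod n)) (?x (Suc (j mod n)))"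
    using ij(3,4) by (simp_all add: unroll_mod unroll_Suc_mod)
  moreover have "i mod n < n" "j mod n < n"
    using ij(1,2) by simp_all
  ultimately show ?R
    by (metis linorder_neqE_nat)
next
  assume ?R
  then show ?L
    unfolding two_steps_def using trans_less_add2 by blast
qed

text \<open>
  Taking \<open>R\<close> to be \<open>>\<close> or \<open><\<close> covers cyclic and anti-cyclic sequences at once.
\<close>

lemma card_steps_le_one_iff:
  fixes f :: "nat \<Rightarrow> 'a"
  shows "card {i. i < length (map f [0..<n]) \<and>
                R (map f [0..<n] ! i) (map f [0..<n] ! ((i + 1) mod length (map f [0..<n])))} \<le> 1
         \<longleftrightarrow> \<not> two_steps R n (unroll n f)"
proof -
  let ?x = "unroll n f"
  define A where "A = {i. i < n \<and> R (?x i) (?x (Suc i))}"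
  have A: "{i. i < length (map f [0..<n]) \<and>
                R (map f [0..<n] ! i) (map f [0..<n] ! ((i + 1) mod length (map f [0..<n])))} = A"
    unfolding A_def unroll_def by (intro Collect_cong) auto
  have "finite A"
    by (simp add: A_def)
  then have "card A \<le> 1 \<longleftrightarrow> (\<forall>i\<in>A. \<forall>j\<in>A. i = j)"
    using card_le_Suc0_iff_eq[of A] by simp
  also have "\<dots> \<longleftrightarrow> \<not> (\<exists>i j. i < j \<and> i \<in> A \<and> j \<in> A)"
    by (metis linorder_neqE_nat less_irrefl)
  also have "\<dots> \<longleftrightarrow> \<not> two_steps R n ?x"
    unfolding two_steps_unroll_iff A_def by (auto dest: less_trans)
  finally show ?thesis
    unfolding A .
qed

section \<open>Oriented quadruples\<close>

text \<open>
  The explicit list of the six pairs among the four steps of a quadruple replaces counting by a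
  propositional condition, on which rotation and reversal merely permute the disjuncts.
\<close>

lemma card_steps_quad_le_one_iff:
  "card {i. i < length [a, b, c, d] \<and> R ([a, b, c, d] ! i) ([a, b, c, d] ! ((i + 1) mod length [a, b, c, d]))} \<le> 1
     \<longleftrightarrow> \<not> (R a b \<and> R b c \<or> R a b \<and> R c d \<or> R a b \<and> R d a \<or>
            R b c \<and> R c d \<or> R b c \<and> R d a \<or> R c d \<and> R d a)"
proof -
  define S where "S i = R ([a, b, c, d] ! i) ([a, b, c, d] ! ((i + 1) mod 4))" for i
  have S: "S 0 = R a b" "S 1 = R b c" "S 2 = R c d" "S 3 = R d a"
    by (simp_all add: S_def)
  have length: "length [a, b, c, d] = 4"
    by simp
  have all4: "(\<forall>i<4. P i) \<longleftrightarrow> P 0 \<and> P 1 \<and> P 2 \<and> P 3" for P :: "nat \<Rightarrow> bool"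
    by (simp add: numeral_eq_Suc All_less_Suc conj_ac)
  have "card {i. i < 4 \<and> S i} \<le> 1 \<longleftrightarrow> (\<forall>i\<in>{i. i < 4 \<and> S i}. \<forall>j\<in>{i. i < 4 \<and> S i}. i = j)"
    using card_le_Suc0_iff_eq[of "{i. i < 4 \<and> S i}"] by simp
  also have "\<dots> \<longleftrightarrow> (\<forall>i<4. \<forall>j<4. S i \<longrightarrow> S j \<longrightarrow> i = j)"
    by blast
  also have "\<dots> \<longleftrightarrow> \<not> (S 0 \<and> S 1 \<or> S 0 \<and> S 2 \<or> S 0 \<and> S 3 \<or> S 1 \<and> S 2 \<or> S 1 \<and> S 3 \<or> S 2 \<and> S 3)"
    unfolding all4 by auto
  finally show ?thesis
    unfolding length S_def[symmetric] S .
qed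

lemma cyclic_quad_iff:
  "cyclic_seq [a, b, c, d] \<longleftrightarrow>
     \<not> (a > b \<and> b > c \<or> a > b \<and> c > d \<or> a > b \<and> d > a \<or>
        b > c \<and> c > d \<or> b > c \<and> d > a \<or> c > d \<and> d > a)"
  unfolding cyclic_seq_def by (rule card_steps_quad_le_one_iff)

lemma anticyclic_quad_iff:
  "anticyclic_seq [a, b, c, d] \<longleftrightarrow>
     \<not> (a < b \<and> b < c \<or> a < b \<and> c < d \<or> a < b \<and> d < a \<or>
        b < c \<and> c < d \<or> b < c \<and> d < a \<or> c < d \<and> d < a)"
  unfolding anticyclic_seq_def by (rule card_steps_quad_le_one_iff)

lemma anticyclic_quad_rev: "anticyclic_seq [a, b, c, d] \<longleftrightarrow> cyclic_seq [d, c, b, a]"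
  by (simp only: cyclic_quad_iff anticyclic_quad_iff conj_ac disj_ac)

lemma cyclic_quad_iff_rotated_sorted:
  "cyclic_seq [a, b, c, d] \<longleftrightarrow>
     a \<le> b \<and> b \<le> c \<and> c \<le> d \<or> b \<le> c \<and> c \<le> d \<and> d \<le> a \<or>
     c \<le> d \<and> d \<le> a \<and> a \<le> b \<or> d \<le> a \<and> a \<le> b \<and> b \<le> c"
  unfolding cyclic_quad_iff not_less[symmetric]
  by (cases "b < a"; cases "c < b"; cases "d < c"; cases "a < d"; simp only: simp_thms)

lemma cyclic_quad_rotate: "cyclic_seq [b, c, d, a] \<longleftrightarrow> cyclic_seq [a, b, c, d]"
  by (simp only: cyclic_quad_iff conj_ac disj_ac)

lemma oriented_quad_rotate: "oriented_seq [b, c, d, a] \<longleftrightarrow> oriented_seq [a, b, c, d]"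
  unfolding oriented_seq_def anticyclic_quad_rev
  using cyclic_quad_rotate[of b c d a] cyclic_quad_rotate[of d c b a] by (simp only:)

lemma oriented_quad_rev: "oriented_seq [d, c, b, a] \<longleftrightarrow> oriented_seq [a, b, c, d]"
  unfolding oriented_seq_def anticyclic_quad_rev by (rule disj_commute)

text \<open>
  The combinatorial form of two chords missing each other: \<open>b\<close> and \<open>d\<close> lie on the same open arc
  cut off by \<open>a\<close> and \<open>c\<close>. Otherwise the closed arcs separate \<open>b\<close> from \<open>d\<close>, and one of the four
  sorted chains below arises.
\<close>

lemma not_oriented_quad_same_side:
  assumes "\<not> oriented_seq [a, b, c, d]" "a < c"
  shows "a < b \<and> b < c \<and> a < d \<and> d < c \<or> (b < a \<or> c < b) \<and> (d < a \<or> c < d)"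
proof (rule ccontr)
  assume "\<not> ?thesis"
  then consider "a \<le> b" "b \<le> c" "c \<le> d" | "d \<le> a" "a \<le> b" "b \<le> c"
    | "b \<le> a" "a \<le> d" "d \<le> c" | "a \<le> d" "d \<le> c" "c \<le> b"
    using \<open>a < c\<close> by linarith
  then have "oriented_seq [a, b, c, d]"
    unfolding oriented_seq_def anticyclic_quad_rev cyclic_quad_iff_rotated_sorted by cases simp_all
  with assms(1) show False ..
qed

section \<open>Detecting failures of orientation in quadruples\<close>

text \<open>
  A strict comparison between two places of a sequence is inherited by a pair of neighbours in
  between. The first hypothesis, transitivity of the complement of \<open>R\<close>, is what lets the
  comparison be pushed down to neighbours; it holds for \<open><\<close> and for \<open>>\<close>.
\<close>

lemma step_between:
  assumes  "\<And>u v w. R u w \<Longrightarrow> R u v \<or> R v w"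
    and irrefl: "\<And>u. \<not> R u u"
    and "a \<le> b" "R (x a) (x b)"
  shows "\<exists>i. a \<le> i \<and> i < b \<and> R (x i) (x (Suc i))"
  using \<open>a \<le> b\<close> \<open>R (x a) (x b)\<close>
proof (induction b rule: dec_induct)
  case base
  then show ?case
    using irrefl by blast
next
  case (step b)
  then show ?case
    using assms(1)[of "x a" "x (Suc b)" "x b"] less_Suc_eq by blast
qed

lemma two_steps_of_two_jumps:
  assumes "\<And>u v w. R u w \<Longrightarrow> R u v \<or> R v w" and "\<And>u. \<not> R u u"
    and "a \<le> b" "b \<le> c" "c \<le> d" "d \<le> a + n"
    and "R (x a) (x b)" "R (x c) (x d)"
  shows "two_steps R n x"
proof -
  obtain i where i: "a \<le> i" "i < b" "R (x i) (x (Suc i))"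
    using step_between[of R a b x] assms by blast
  obtain j where j: "c \<le> j" "j < d" "R (x j) (x (Suc j))"
    using step_between[of R c d x] assms by blast
  show ?thesis
    unfolding two_steps_def using i j assms(3-6) by (intro exI[of _ i] exI[of _ j]) auto
qed

text \<open>
  The step from the last to the first member of the quadruple is the jump from \<open>d\<close> to \<open>a + n\<close>.
\<close>

lemma two_steps_of_quad:
  assumes R: "\<And>u v w. R u w \<Longrightarrow> R u v \<or> R v w" "\<And>u. \<not> R u u"
    and le: "a \<le> b" "b \<le> c" "c \<le> d" "d \<le> a + n"
    and periodic: "\<And>i. x (i + n) = x i"
    and steps: "R (x a) (x b) \<and> R (x b) (x c) \<or> R (x a) (x b) \<and> R (x c) (x d) \<or>
        R (x a) (x b) \<and> R (x d) (x a) \<or> R (x b) (x c) \<and> R (x c) (x d) \<or>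
        R (x b) (x c) \<and> R (x d) (x a) \<or> R (x c) (x d) \<and> R (x d) (x a)"
  shows "two_steps R n x"
proof -
  have a: "x (a + n) = x a"
    by (rule periodic)
  note jumps = two_steps_of_two_jumps[of R _ _ _ _ n x, OF R]
  have "R (x a) (x b) \<Longrightarrow> R (x b) (x c) \<Longrightarrow> two_steps R n x"
    by (rule jumps[of a b b c]) (use le in auto)
  moreover have "R (x a) (x b) \<Longrightarrow> R (x c) (x d) \<Longrightarrow> two_steps R n x"
    by (rule jumps[of a b c d]) (use le in auto)
  moreover have "R (x a) (x b) \<Longrightarrow> R (x d) (x a) \<Longrightarrow> two_steps R n x"
    by (rule jumps[of a b d "a + n"]) (use le a in auto)
  moreover have "R (x b) (x c) \<Longrightarrow> R (x c) (x d) \<Longrightarrow> two_steps R n x"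
    by (rule jumps[of b c c d]) (use le in auto)
  moreover have "R (x b) (x c) \<Longrightarrow> R (x d) (x a) \<Longrightarrow> two_steps R n x"
    by (rule jumps[of b c d "a + n"]) (use le a in auto)
  moreover have "R (x c) (x d) \<Longrightarrow> R (x d) (x a) \<Longrightarrow> two_steps R n x"
    by (rule jumps[of c d d "a + n"]) (use le a in auto)
  ultimately show ?thesis
    using steps by blast
qed

lemma two_steps_of_not_oriented:
  assumes "a \<le> b" "b \<le> c" "c \<le> d" "d \<le> a + n"
    and "\<And>i. x (i + n) = x i"
    and "\<not> oriented_seq [x a, x b, x c, x d]"
  shows "two_steps (>) n x \<and> two_steps (<) n x"
proof -
  have "\<not> cyclic_seq [x a, x b, x c, x d]" "\<not> anticyclic_seq [x a, x b, x c, x d]"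
    using assms(6) by (simp_all only: oriented_seq_def simp_thms de_Morgan_disj)
  note steps = this[unfolded cyclic_quad_iff anticyclic_quad_iff not_not]
  have "two_steps (>) n x"
    by (rule two_steps_of_quad[of "(>)" a b c d n x, OF _ _ assms(1-5) steps(1)]) auto
  moreover have "two_steps (<) n x"
    by (rule two_steps_of_quad[of "(<)" a b c d n x, OF _ _ assms(1-5) steps(2)]) auto
  ultimately show ?thesis ..
qed

text \<open>
  Between a step up and the following step down there is a peak: the end of the former or the start
  of the latter, whichever is higher. Likewise there is a valley between a step down and the
  following step up. The four extrema alternate strictly, hence form a quadruple with two
  ascents and two descents.
\<close>

lemma not_oriented_of_alternating_steps:
  fixes x :: "nat \<Rightarrow> nat"
  assumes "i0 < i1" "i1 < i2" "i2 < i3" "i3 < i0 + n"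
    and periodic: "\<And>i. x (i + n) = x i"
    and "x i0 < x (Suc i0)" "x i1 > x (Suc i1)" "x i2 < x (Suc i2)" "x i3 > x (Suc i3)"
  shows "\<exists>a b c d. a \<le> b \<and> b \<le> c \<and> c \<le> d \<and> d \<le> a + n \<and> \<not> oriented_seq [x a, x b, x c, x d]"
proof -
  \<comment> \<open>Peaks at \<open>b\<close> and \<open>d\<close>, valleys at \<open>c\<close> and \<open>a\<close>; the last valley closes the period.\<close>
  define b where "b = (if x i1 \<le> x (Suc i0) then Suc i0 else i1)"
  define c where "c = (if x i2 \<ge> x (Suc i1) then Suc i1 else i2)"
  define d where "d = (if x i3 \<le> x (Suc i2) then Suc i2 else i3)"
  define a where "a = (if x i0 \<ge> x (Suc i3) then Suc i3 else i0 + n)"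
  have "b \<le> c" "c \<le> d" "d \<le> a" "a \<le> b + n"
    using assms(1-4) unfolding a_def b_def c_def d_def by auto
  moreover have "x b > x c" "x c < x d" "x d > x a" "x a < x b"
    using assms(6-9) unfolding a_def b_def c_def d_def by (auto simp: periodic)
  then have "\<not> oriented_seq [x b, x c, x d, x a]"
    unfolding oriented_seq_def cyclic_quad_iff anticyclic_quad_iff by auto
  ultimately show ?thesis
    by blast
qed

text \<open>
  If the sequence drops somewhere between the two steps up, or rises between the two steps
  down, then the extra step gives four alternating steps. Otherwise the first ascent
  ends at a value strictly between the valley and the peak, and so does the first descent;
  together with the valley and the peak these values show two ascents followed by two descents.
\<close>

lemma not_oriented_of_grouped_steps:
  fixes x :: "nat \<Rightarrow> nat"
  assumes "i0 < i1" "i1 < i2" "i2 < i3" "i3 < i0 + n"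
    and periodic: "\<And>i. x (i + n) = x i"
    and "x i0 < x (Suc i0)" "x i1 < x (Suc i1)" "x i2 > x (Suc i2)" "x i3 > x (Suc i3)"
  shows "\<exists>a b c d. a \<le> b \<and> b \<le> c \<and> c \<le> d \<and> d \<le> a + n \<and> \<not> oriented_seq [x a, x b, x c, x d]"
proof -
  consider "x (Suc i0) > x i1" | "x (Suc i2) < x i3" | "x (Suc i0) \<le> x i1" "x (Suc i2) \<ge> x i3"
    by linarith
  then show ?thesis
  proof cases
    case 1
    have "\<exists>k. Suc i0 \<le> k \<and> k < i1 \<and> x k > x (Suc k)"
      by (rule step_between[of "(>)"]) (use assms(1) 1 in auto)
    then obtain k where k: "Suc i0 \<le> k" "k < i1" "x k > x (Suc k)"
      by blast
    show ?thesis
      by (rule not_oriented_of_alternating_steps[of i0 k i1 i2]) (use k assms in auto)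
  next
    case 2
    have "\<exists>k. Suc i2 \<le> k \<and> k < i3 \<and> x k < x (Suc k)"
      by (rule step_between[of "(<)"]) (use assms(3) 2 in auto)
    then obtain k where k: "Suc i2 \<le> k" "k < i3" "x k < x (Suc k)"
      by blast
    show ?thesis
      by (rule not_oriented_of_alternating_steps[of i1 i2 k i3]) (use k assms in auto)
  next
    case 3
    \<comment> \<open>The peak is at \<open>c\<close>, the valley at \<open>a\<close>.\<close>
    define c where "c = (if x i2 \<le> x (Suc i1) then Suc i1 else i2)"
    define a where "a = (if x i0 \<ge> x (Suc i3) then Suc i3 else i0 + n)"
    have "Suc i0 \<le> c" "c \<le> Suc i2" "Suc i2 \<le> a" "a \<le> Suc i0 + n"
      using assms(1-4) unfolding a_def c_def by auto
    moreover have "x (Suc i0) < x c" "x c > x (Suc i2)" "x (Suc i2) > x a" "x a < x (Suc i0)"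
      using assms(6-9) 3 unfolding a_def c_def by (auto simp: periodic)
    then have "\<not> oriented_seq [x (Suc i0), x c, x (Suc i2), x a]"
      unfolding oriented_seq_def cyclic_quad_iff anticyclic_quad_iff by auto
    ultimately show ?thesis
      by blast
  qed
qed

text \<open>
  Two ascents and two descents can occur in six orders within a period. Rotation, that is
  shifting some leading steps by \<open>n\<close>, reduces them to the alternating and the grouped order.
\<close>

lemma not_oriented_of_two_steps:
  fixes f :: "nat \<Rightarrow> nat" and n :: nat
  defines "x \<equiv> unroll n f"
  assumes "two_steps (>) n x" "two_steps (<) n x"
  shows "\<exists>a b c d. a \<le> b \<and> b \<le> c \<and> c \<le> d \<and> d \<le> a + n \<and> \<not> oriented_seq [x a, x b, x c, x d]"
proof -
  have periodic: "x (i + n) = x i" for i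
    by (simp add: x_def unroll_add)
  have periodic_Suc: "x (Suc (i + n)) = x (Suc i)" for i
    using periodic[of "Suc i"] by simp
  obtain i j where ij: "i < j" "j < n" "x i < x (Suc i)" "x j < x (Suc j)"
    using assms(3) unfolding two_steps_unroll_iff x_def by blast
  obtain k l where kl: "k < l" "l < n" "x k > x (Suc k)" "x l > x (Suc l)"
    using assms(2) unfolding two_steps_unroll_iff x_def by blast
  have "i \<noteq> k" "i \<noteq> l" "j \<noteq> k" "j \<noteq> l"
    using ij kl by auto
  note A = not_oriented_of_alternating_steps[of _ _ _ _ n x, OF _ _ _ _ periodic]
  note G = not_oriented_of_grouped_steps[of _ _ _ _ n x, OF _ _ _ _ periodic]
  consider "i < j" "j < k" "k < l" | "i < k" "k < j" "j < l" | "i < k" "k < l" "l < j"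
    | "k < i" "i < j" "j < l" | "k < i" "i < l" "l < j" | "k < l" "l < i" "i < j"
    using ij kl \<open>i \<noteq> k\<close> \<open>i \<noteq> l\<close> \<open>j \<noteq> k\<close> \<open>j \<noteq> l\<close> by linarith
  then show ?thesis
  proof cases
    case 1
    then show ?thesis
      using ij kl by (intro G[of i j k l]) auto
  next
    case 2
    then show ?thesis
      using ij kl by (intro A[of i k j l]) auto
  next
    case 3
    then show ?thesis
      using ij kl by (intro G[of j "i + n" "k + n" "l + n"]) (auto simp: periodic periodic_Suc)
  next
    case 4
    then show ?thesis
      using ij kl by (intro G[of i j l "k + n"]) (auto simp: periodic periodic_Suc)
  next
    case 5
    then show ?thesis
      using ij kl by (intro A[of i l j "k + n"]) (auto simp: periodic periodic_Suc)
  next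
    case 6
    then show ?thesis
      using ij kl by (intro G[of i j "k + n" "l + n"]) (auto simp: periodic periodic_Suc)
  qed
qed

lemma not_in_P_iff:
  assumes "\<alpha> \<in> full_transf n"
  shows "\<alpha> \<notin> P_set n \<longleftrightarrow>
    (\<exists>a b c d. a \<le> b \<and> b \<le> c \<and> c \<le> d \<and> d \<le> a + n \<and>
       \<not> oriented_seq [unroll n \<alpha> a, unroll n \<alpha> b, unroll n \<alpha> c, unroll n \<alpha> d])"
proof -
  have "cyclic_seq (map \<alpha> [0..<n]) \<longleftrightarrow> \<not> two_steps (>) n (unroll n \<alpha>)"
    unfolding cyclic_seq_def by (rule card_steps_le_one_iff)
  moreover have "anticyclic_seq (map \<alpha> [0..<n]) \<longleftrightarrow> \<not> two_steps (<) n (unroll n \<alpha>)"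
    unfolding anticyclic_seq_def by (rule card_steps_le_one_iff)
  ultimately have "\<alpha> \<notin> P_set n \<longleftrightarrow> two_steps (>) n (unroll n \<alpha>) \<and> two_steps (<) n (unroll n \<alpha>)"
    using assms unfolding P_set_def OP_set_def OR_set_def by auto
  then show ?thesis
    using two_steps_of_not_oriented[of _ _ _ _ n "unroll n \<alpha>", OF _ _ _ _ unroll_add]
      not_oriented_of_two_steps[where n = n and f = \<alpha>] by blast
qed

text \<open>
  This lemma and the next one say together that cyclic quadruples of \<open>[n]\<close> are the same
  as weakly increasing quadruples within one period, read modulo \<open>n\<close>.
\<close>

lemma cyclic_quad_mod:
  fixes n :: nat
  assumes "n \<ge> 1" "a \<le> b" "b \<le> c" "c \<le> d" "d \<le> a + n"
  shows "cyclic_seq [a mod n, b mod n, c mod n, d mod n]"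
proof -
  \<comment> \<open>The period containing \<open>a\<close> starts at \<open>q\<close>; the cases below say how many of
    \<open>b\<close>, \<open>c\<close>, \<open>d\<close> have passed its end.\<close>
  define q where "q = a div n * n"
  have a: "q \<le> a" "a < q + n"
    using assms(1) dividend_less_div_times[of n a] unfolding q_def by auto
  have m: "y mod n = (if y < q + n then y - q else y - q - n)" if "a \<le> y" "y \<le> a + n" for y
  proof -
    have "y mod n = (y - q) mod n"
      using that a(1) unfolding q_def
      by (metis le_add_diff_inverse2 le_trans mod_mult_self1)
    also have "\<dots> = (if y < q + n then y - q else y - q - n)"
      using that a by (auto simp: le_mod_geq)
    finally show ?thesis .
  qed
  have "b \<le> a + n" "c \<le> a + n" "a \<le> c" "a \<le> d"
    using assms(2-5) by simp_all
  then have mods: "a mod n = a - q" "b mod n = (if b < q + n then b - q else b - q - n)"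
    "c mod n = (if c < q + n then c - q else c - q - n)"
    "d mod n = (if d < q + n then d - q else d - q - n)"
    using m[of a] m[of b] m[of c] m[of d] assms(2-5) a by simp_all
  consider "d < q + n" | "c < q + n" "q + n \<le> d" | "b < q + n" "q + n \<le> c" | "q + n \<le> b"
    by linarith
  then show ?thesis
  proof cases
    case 1
    then have "a mod n \<le> b mod n" "b mod n \<le> c mod n" "c mod n \<le> d mod n"
      using assms(2-5) a by (simp_all add: mods diff_le_mono le_diff_conv)
    then show ?thesis
      by (simp add: cyclic_quad_iff_rotated_sorted)
  next
    case 2
    then have "d mod n \<le> a mod n" "a mod n \<le> b mod n" "b mod n \<le> c mod n"
      using assms(2-5) a by (simp_all add: mods diff_le_mono le_diff_conv)
    then show ?thesis
      by (simp add: cyclic_quad_iff_rotated_sorted)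
  next
    case 3
    then have "c mod n \<le> d mod n" "d mod n \<le> a mod n" "a mod n \<le> b mod n"
      using assms(2-5) a by (simp_all add: mods diff_le_mono le_diff_conv)
    then show ?thesis
      by (simp add: cyclic_quad_iff_rotated_sorted)
  next
    case 4
    then have "b mod n \<le> c mod n" "c mod n \<le> d mod n" "d mod n \<le> a mod n"
      using assms(2-5) a by (simp_all add: mods diff_le_mono le_diff_conv)
    then show ?thesis
      by (simp add: cyclic_quad_iff_rotated_sorted)
  qed
qed

lemma cyclic_quad_unroll:
  assumes "a < n" "b < n" "c < n" "d < n" "cyclic_seq [a, b, c, d]"
  shows "\<exists>b' c' d'. a \<le> b' \<and> b' \<le> c' \<and> c' \<le> d' \<and> d' \<le> a + n \<and>
           b' mod n = b \<and> c' mod n = c \<and> d' mod n = d"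
proof -
  have [simp]: "(y + n) mod n = y" "y mod n = y" if "y < n" for y
    using that by simp_all
  consider "a \<le> b" "b \<le> c" "c \<le> d" | "d \<le> a" "a \<le> b" "b \<le> c" | "c \<le> d" "d \<le> a" "a \<le> b"
    | "b \<le> c" "c \<le> d" "d \<le> a"
    using assms(5) unfolding cyclic_quad_iff_rotated_sorted by blast
  then show ?thesis
  proof cases
    case 1
    then show ?thesis
      using assms by (intro exI[of _ b] exI[of _ c] exI[of _ d]) auto
  next
    case 2
    then show ?thesis
      using assms by (intro exI[of _ b] exI[of _ c] exI[of _ "d + n"]) auto
  next
    case 3
    then show ?thesis
      using assms by (intro exI[of _ b] exI[of _ "c + n"] exI[of _ "d + n"]) auto
  next
    case 4
    then show ?thesis
      using assms by (intro exI[of _ "b + n"] exI[of _ "c + n"] exI[of _ "d + n"]) auto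
  qed
qed

text \<open>
  Orientedness is invariant under reversal, so only cyclic quadruples of places matter, and these
  are the quadruples within one period of the previous characterisation.
\<close>

lemma in_P_iff_preserves_oriented_quads:
  assumes "n \<ge> 1" "\<alpha> \<in> full_transf n"
  shows "\<alpha> \<in> P_set n \<longleftrightarrow>
            (\<forall>a<n. \<forall>b<n. \<forall>c<n. \<forall>d<n.
               oriented_seq [a, b, c, d] \<longrightarrow> oriented_seq (map \<alpha> [a, b, c, d]))"
proof (intro iffI allI impI)
  assume P: "\<alpha> \<in> P_set n"
  have cyc: "oriented_seq [\<alpha> a, \<alpha> b, \<alpha> c, \<alpha> d]"
    if less: "a < n" "b < n" "c < n" "d < n" and cyclic: "cyclic_seq [a, b, c, d]" for a b c d
  proof -
    obtain b' c' d' where *: "a \<le> b'" "b' \<le> c'" "c' \<le> d'" "d' \<le> a + n"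
        "b' mod n = b" "c' mod n = c" "d' mod n = d"
      using cyclic_quad_unroll[OF less cyclic] by blast
    then have "oriented_seq [unroll n \<alpha> a, unroll n \<alpha> b', unroll n \<alpha> c', unroll n \<alpha> d']"
      using P not_in_P_iff[OF assms(2)] by blast
    then show ?thesis
      using * less(1) by (simp add: unroll_def)
  qed
  fix a b c d
  assume less: "a < n" "b < n" "c < n" "d < n" and "oriented_seq [a, b, c, d]"
  then consider "cyclic_seq [a, b, c, d]" | "cyclic_seq [d, c, b, a]"
    unfolding oriented_seq_def anticyclic_quad_rev by blast
  then show "oriented_seq (map \<alpha> [a, b, c, d])"
    using cyc[of a b c d] cyc[of d c b a] less by cases (simp_all add: oriented_quad_rev)
next
  assume *: "\<forall>a<n. \<forall>b<n. \<forall>c<n. \<forall>d<n.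
               oriented_seq [a, b, c, d] \<longrightarrow> oriented_seq (map \<alpha> [a, b, c, d])"
  show "\<alpha> \<in> P_set n"
  proof (rule ccontr)
    assume "\<alpha> \<notin> P_set n"
    then obtain a b c d where le: "a \<le> b" "b \<le> c" "c \<le> d" "d \<le> a + n"
        and no: "\<not> oriented_seq [unroll n \<alpha> a, unroll n \<alpha> b, unroll n \<alpha> c, unroll n \<alpha> d]"
      using not_in_P_iff[OF assms(2)] by blast
    have "oriented_seq [a mod n, b mod n, c mod n, d mod n]"
      using cyclic_quad_mod[OF assms(1) le] by (simp add: oriented_seq_def)
    then have "oriented_seq (map \<alpha> [a mod n, b mod n, c mod n, d mod n])"
      using * assms(1) by simp
    then show False
      using no by (simp add: unroll_def)
  qed
qed

section \<open>Chords of a circle\<close>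

text \<open>
  Twice the signed area of the triangle \<open>u v w\<close>, negative if its vertices run clockwise.
\<close>

definition signed_area :: "complex \<Rightarrow> complex \<Rightarrow> complex \<Rightarrow> real" where
  "signed_area u v w = (Re v - Re u) * (Im w - Im u) - (Im v - Im u) * (Re w - Re u)"

lemma signed_area_rotate: "signed_area v w u = signed_area u v w"
  by (simp add: signed_area_def algebra_simps)

lemma signed_area_swap: "signed_area u w v = - signed_area u v w"
  by (simp add: signed_area_def algebra_simps)

lemma signed_area_on_line: "signed_area u v ((1 - t) *\<^sub>R u + t *\<^sub>R v) = 0"
  by (simp add: signed_area_def algebra_simps)

lemma signed_area_affine:
  "signed_area u v ((1 - t) *\<^sub>R w + t *\<^sub>R w') = (1 - t) * signed_area u v w + t * signed_area u v w'"
  by (simp add: signed_area_def algebra_simps)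

text \<open>
  The signed area with \<open>u\<close> and \<open>v\<close> fixed is affine in the third vertex; it vanishes on the first
  segment and has constant strict sign on the second.
\<close>

lemma segments_disjoint_of_same_side:
  assumes "signed_area u v w * signed_area u v w' > 0"
  shows "closed_segment u v \<inter> closed_segment w w' = {}"
proof -
  have False if on: "q \<in> closed_segment u v" "q \<in> closed_segment w w'" for q
  proof -
    obtain s where s: "q = (1 - s) *\<^sub>R u + s *\<^sub>R v"
      using on(1) unfolding in_segment by blast
    obtain t where t: "0 \<le> t" "t \<le> 1" "q = (1 - t) *\<^sub>R w + t *\<^sub>R w'"
      using on(2) unfolding in_segment by blast
    let ?f = "signed_area u v"
    have 0: "(1 - t) * ?f w + t * ?f w' = 0"
      using signed_area_on_line[of u v s] signed_area_affine[of u v t w w'] s t(3) by simp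
    from assms consider "?f w > 0" "?f w' > 0" | "?f w < 0" "?f w' < 0"
      by (auto simp: zero_less_mult_iff)
    then show False
    proof cases
      case 1
      then show ?thesis
        using 0 t convex_bound_lt[of "- ?f w" 0 "- ?f w'" "1 - t" t] by simp
    next
      case 2
      then show ?thesis
        using 0 t convex_bound_lt[of "?f w" 0 "?f w'" "1 - t" t] by simp
    qed
  qed
  then show ?thesis
    by blast
qed

text \<open>
  The affine dependence between four points of the plane, with the signed areas of the triangles
  they form as coefficients. Both sides become the crossing point of the diagonals once divided by
  the common sum of their coefficients.
\<close>

lemma signed_area_dependence:
  "signed_area v w w' *\<^sub>R u + signed_area u v w' *\<^sub>R w
     = signed_area u w w' *\<^sub>R v + signed_area u v w *\<^sub>R w'"
  by (simp add: signed_area_def complex_eq_iff algebra_simps)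

lemma signed_area_split:
  "signed_area v w w' + signed_area u v w' = signed_area u w w' + signed_area u v w"
  by (simp add: signed_area_def algebra_simps)

lemma diagonals_meet:
  assumes "signed_area u v w < 0" "signed_area v w w' < 0"
    "signed_area u w w' < 0" "signed_area u v w' < 0"
  shows "closed_segment u w \<inter> closed_segment v w' \<noteq> {}"
proof -
  define S where "S = signed_area v w w' + signed_area u v w'"
  have S: "S < 0" "S = signed_area u w w' + signed_area u v w"
    using assms signed_area_split unfolding S_def by simp_all
  define q where "q = (1 / S) *\<^sub>R (signed_area v w w' *\<^sub>R u + signed_area u v w' *\<^sub>R w)"
  have q': "q = (1 / S) *\<^sub>R (signed_area u w w' *\<^sub>R v + signed_area u v w *\<^sub>R w')"
    unfolding q_def signed_area_dependence ..
  have "1 - signed_area u v w' / S = signed_area v w w' / S"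
    "1 - signed_area u v w / S = signed_area u w w' / S"
    using S by (simp_all add: S_def field_simps)
  then have "q = (1 - signed_area u v w' / S) *\<^sub>R u + (signed_area u v w' / S) *\<^sub>R w"
    "q = (1 - signed_area u v w / S) *\<^sub>R v + (signed_area u v w / S) *\<^sub>R w'"
    by (simp add: q_def scaleR_right_distrib, simp add: q' scaleR_right_distrib)
  moreover have "0 \<le> signed_area u v w' / S" "signed_area u v w' / S \<le> 1"
    "0 \<le> signed_area u v w / S" "signed_area u v w / S \<le> 1"
    using S assms by (simp_all add: divide_le_eq zero_le_divide_iff S_def)
  ultimately have "q \<in> closed_segment u w" "q \<in> closed_segment v w'"
    unfolding in_segment by blast+
  then show ?thesis
    by blast
qed

text \<open>
  This identity turns the area of a triangle inscribed in a circle into a product of sines of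
  half the central angles, from which its sign can be read off.
\<close>

lemma sin_double_sum:
  fixes u v :: real
  shows "sin (2 * u) + sin (2 * v) - sin (2 * u + 2 * v) = 4 * sin u * sin v * sin (u + v)"
proof -
  have "sin (2 * u) + sin (2 * v) - sin (2 * u + 2 * v)
      = sin (2 * u) * (1 - cos (2 * v)) + sin (2 * v) * (1 - cos (2 * u))"
    by (simp add: sin_add algebra_simps)
  also have "\<dots> = 4 * sin u * sin v * sin (u + v)"
    unfolding sin_double cos_double_sin sin_add by (simp add: power2_eq_square algebra_simps)
  finally show ?thesis .
qed

lemma signed_area_circle:
  "signed_area (z + of_real r * cis A) (z + of_real r * cis B) (z + of_real r * cis C)
     = - 4 * r\<^sup>2 * sin ((A - B) / 2) * sin ((B - C) / 2) * sin ((A - C) / 2)"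
proof -
  define u v where "u = (A - B) / 2" and "v = (B - C) / 2"
  have double: "A - B = 2 * u" "B - C = 2 * v" "A - C = 2 * u + 2 * v"
    by (simp_all add: u_def v_def field_simps)
  have "signed_area (z + of_real r * cis A) (z + of_real r * cis B) (z + of_real r * cis C)
      = - r\<^sup>2 * (sin (A - B) + sin (B - C) - sin (A - C))"
    by (simp add: signed_area_def sin_diff power2_eq_square algebra_simps)
  also have "sin (A - B) + sin (B - C) - sin (A - C)
      = 4 * sin ((A - B) / 2) * sin ((B - C) / 2) * sin ((A - C) / 2)"
    unfolding double sin_double_sum by (simp add: add_divide_distrib)
  finally show ?thesis
    by simp
qed

text \<open>
  All three half differences of angles lie strictly between \<open>0\<close> and \<open>\<pi>\<close>, so every sine
  in the product formula is positive. This is where the points going round at most once enters.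
\<close>

lemma clockwise_signed_area_neg:
  assumes "clockwise_placement n p" "i < j" "j < k" "k < n"
  shows "signed_area (p i) (p j) (p k) < 0"
proof -
  obtain z r \<theta> where r: "r > 0"
    and \<theta>: "\<And>i j. i < n \<Longrightarrow> j < n \<Longrightarrow> i < j \<Longrightarrow> \<theta> j < \<theta> i \<and> \<theta> i - \<theta> j < 2 * pi"
    and p: "\<And>k. k < n \<Longrightarrow> p k = z + of_real r * cis (\<theta> k)"
    using assms(1) unfolding clockwise_placement_def by metis
  have "sin ((\<theta> i - \<theta> j) / 2) > 0" "sin ((\<theta> j - \<theta> k) / 2) > 0" "sin ((\<theta> i - \<theta> k) / 2) > 0"
    using \<theta>[of i j] \<theta>[of j k] \<theta>[of i k] assms(2-4) by (auto intro!: sin_gt_zero)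
  then show ?thesis
    using assms(2-4) r by (simp add: p signed_area_circle)
qed

lemma clockwise_placement_inj:
  assumes "clockwise_placement n p" "i < n" "j < n" "i \<noteq> j"
  shows "p i \<noteq> p j"
proof -
  have "p i \<noteq> p j" if ij: "i < j" "j < n" for i j
  proof
    assume eq: "p i = p j"
    obtain z r \<theta> where r: "r > 0"
      and \<theta>: "\<And>i j. i < n \<Longrightarrow> j < n \<Longrightarrow> i < j \<Longrightarrow> \<theta> j < \<theta> i \<and> \<theta> i - \<theta> j < 2 * pi"
      and p: "\<And>k. k < n \<Longrightarrow> p k = z + of_real r * cis (\<theta> k)"
      using assms(1) unfolding clockwise_placement_def by metis
    have "cis (\<theta> i) = cis (\<theta> j)"
      using eq ij r by (simp add: p)
    then have "cos (\<theta> i) = cos (\<theta> j)" "sin (\<theta> i) = sin (\<theta> j)"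
      by (simp_all add: complex_eq_iff)
    then have "cos (\<theta> i - \<theta> j) = 1"
      using sin_cos_squared_add3[of "\<theta> j"] by (simp add: cos_diff)
    moreover have "\<theta> i - \<theta> j = 2 * ((\<theta> i - \<theta> j) / 2)"
      by simp
    ultimately have "sin ((\<theta> i - \<theta> j) / 2) = 0"
      by (metis cos_double_sin diff_eq_eq add_cancel_left_right mult_eq_0_iff power_eq_0_iff
          zero_neq_numeral)
    moreover have "sin ((\<theta> i - \<theta> j) / 2) > 0"
      using \<theta>[of i j] ij by (intro sin_gt_zero) auto
    ultimately show False
      by simp
  qed
  then show ?thesis
    using assms(2-4) by (metis linorder_neqE_nat)
qed

lemma chord_commute: "chord p a c = chord p c a"
  by (simp add: chord_def closed_segment_commute)

lemma chords_meet_of_sorted: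
  assumes "clockwise_placement n p" "a < b" "b < c" "c < d" "d < n"
  shows "chord p a c \<inter> chord p b d \<noteq> {}"
  unfolding chord_def using assms
  by (intro diagonals_meet clockwise_signed_area_neg[OF assms(1)]) auto

text \<open>
  If two neighbours of the quadruple coincide, the chords share an endpoint. Otherwise the
  quadruple is a rotation of a strictly increasing one, and a rotation only exchanges the two
  chords or reverses one of them.
\<close>

lemma chords_meet_of_cyclic:
  assumes p: "clockwise_placement n p" and less: "a < n" "b < n" "c < n" "d < n"
    and "cyclic_seq [a, b, c, d]"
  shows "chord p a c \<inter> chord p b d \<noteq> {}"
proof (cases "a = b \<or> b = c \<or> c = d \<or> d = a")
  case True
  then show ?thesis
    unfolding chord_def using ends_in_segment by blast
next
  case False
  then consider "a < b" "b < c" "c < d" | "d < a" "a < b" "b < c" | "c < d" "d < a" "a < b"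
    | "b < c" "c < d" "d < a"
    using assms(6) unfolding cyclic_quad_iff_rotated_sorted by linarith
  then show ?thesis
    using chords_meet_of_sorted[OF p] less chord_commute by cases (metis Int_commute)+
qed

text \<open>
  The points on the arc between \<open>a\<close> and \<open>c\<close> and those on the complementary arc lie strictly on
  opposite sides of the line through \<open>p a\<close> and \<open>p c\<close>.
\<close>

lemma chords_disjoint_of_not_oriented:
  assumes p: "clockwise_placement n p" and less: "a < n" "b < n" "c < n" "d < n"
    and "\<not> oriented_seq [a, b, c, d]" "a < c"
  shows "chord p a c \<inter> chord p b d = {}"
proof -
  let ?area = "\<lambda>k. signed_area (p a) (p c) (p k)"
  have inner: "?area k > 0" if "a < k" "k < c" for k
    using clockwise_signed_area_neg[OF p that less(3)] signed_area_swap[of "p a" "p k" "p c"] by simp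
  have outer: "?area k < 0" if "k < a \<or> c < k" "k < n" for k
    using that clockwise_signed_area_neg[OF p, of k a c] clockwise_signed_area_neg[OF p, of a c k]
      \<open>a < c\<close> less(3) signed_area_rotate[of "p a" "p c" "p k"] by auto
  have "?area b * ?area d > 0"
    using not_oriented_quad_same_side[OF assms(6,7)] inner outer less(2,4)
    by (auto intro: mult_neg_neg)
  then show ?thesis
    unfolding chord_def by (rule segments_disjoint_of_same_side)
qed

text \<open>
  The symmetries of orientedness match those of a pair of chords, so a chord with two different
  endpoints can always be moved into the place of \<open>ac\<close> with \<open>a < c\<close>. If both chords are single
  points, it remains that different places carry different points.
\<close>

lemma chords_meet_iff_oriented:
  assumes p: "clockwise_placement n p" and less: "a < n" "b < n" "c < n" "d < n"
  shows "chord p a c \<inter> chord p b d \<noteq> {} \<longleftrightarrow> oriented_seq [a, b, c, d]"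
proof
  assume "oriented_seq [a, b, c, d]"
  then consider "cyclic_seq [a, b, c, d]" | "cyclic_seq [d, c, b, a]"
    unfolding oriented_seq_def anticyclic_quad_rev by blast
  then show "chord p a c \<inter> chord p b d \<noteq> {}"
    using chords_meet_of_cyclic[OF p] less chord_commute by cases (metis Int_commute)+
next
  assume meet: "chord p a c \<inter> chord p b d \<noteq> {}"
  show "oriented_seq [a, b, c, d]"
  proof (rule ccontr)
    assume no: "\<not> oriented_seq [a, b, c, d]"
    then have no': "\<not> oriented_seq [c, b, a, d]" "\<not> oriented_seq [b, c, d, a]" "\<not> oriented_seq [d, c, b, a]"
      using oriented_quad_rotate oriented_quad_rev by metis+
    note disjoint = chords_disjoint_of_not_oriented[OF p]
    consider "a < c" | "c < a" | "b < d" | "d < b" | "a = c" "b = d"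
      by linarith
    then have "chord p a c \<inter> chord p b d = {}"
    proof cases
      case 1
      then show ?thesis
        using disjoint[of a b c d] no less by simp
    next
      case 2
      then show ?thesis
        using disjoint[of c b a d] no' less chord_commute[of p a c] by simp
    next
      case 3
      then show ?thesis
        using disjoint[of b c d a] no' less chord_commute[of p a c] by (simp add: Int_commute)
    next
      case 4
      then show ?thesis
        using disjoint[of d c b a] no' less chord_commute[of p a c] chord_commute[of p b d]
        by (simp add: Int_commute)
    next
      case 5
      have "a \<noteq> b"
        using no unfolding 5 oriented_seq_def cyclic_quad_iff by auto
      then show ?thesis
        using clockwise_placement_inj[OF p less(1,2)] 5 by (simp add: chord_def)
    qed
    then show False
      using meet by blast
  qed
qed

theorem theorem7:
  fixes n :: nat and \<alpha> :: "nat \<Rightarrow> nat"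
  assumes "n \<ge> 1" and "\<alpha> \<in> full_transf n"
  shows "(\<alpha> \<in> P_set n \<longleftrightarrow>
            (\<forall>a<n. \<forall>b<n. \<forall>c<n. \<forall>d<n.
               oriented_seq [a, b, c, d] \<longrightarrow> oriented_seq (map \<alpha> [a, b, c, d])))
       \<and> (\<forall>p. clockwise_placement n p \<longrightarrow> (chord_property n p \<alpha> \<longleftrightarrow> \<alpha> \<in> P_set n))"
proof (intro conjI allI impI)
  show quads: "\<alpha> \<in> P_set n \<longleftrightarrow>
            (\<forall>a<n. \<forall>b<n. \<forall>c<n. \<forall>d<n.
               oriented_seq [a, b, c, d] \<longrightarrow> oriented_seq (map \<alpha> [a, b, c, d]))"
    by (rule in_P_iff_preserves_oriented_quads[OF assms])
  fix p
  assume p: "clockwise_placement n p"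
  have "\<alpha> k < n" if "k < n" for k
    using assms(2) that unfolding full_transf_def by auto
  then show "chord_property n p \<alpha> \<longleftrightarrow> \<alpha> \<in> P_set n"
    unfolding quads chord_property_def by (simp add: chords_meet_iff_oriented[OF p])
qed

end
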